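(* Suppose $\mathcal{A}$ is a finitely bicomplete preorder. Let $F$ be a monad on $\mathcal{A}$ and let $C$ be a comonad on $\mathcal{A}$. Then there exists a strong model structure on $\mathcal{A}$ whose fibrant replacement monad is $F$, and whose cofibrant replacement comonad is $C$ (up to isomorphism), if and only if the following conditions are all satisfied: (i) $F$ and $C$ are each idempotent, $F$ commutes with $C$ up to isomorphism (i.e. $FCX\cong CFX$ for all $X$), and if $X,Y\in\mathcal{A}$ satisfy $X\leq CY$ and $FX\leq Y$, then $FX\leq CY$. (ii) If $a\leq b$ and $Cb\leq Ca$ and $Fb\leq Fa$, then $b\leq a$. Furthermore, there is a bijection between strong model structures on $\mathcal{A}$ and isomorphism classes of monad-comonad pairs $(F,C)$ satisfying these conditions.
   Context: A preorder (a set with a reflexive transitive relation $\leq$) is regarded as a small category with exactly one morphism $X\to Y$ if $X\leq Y$ and none otherwise; $X\cong Y$ means $X\leq Y\leq X$. Functors are order-preserving maps; a monad $F$ is an order-preserving map with $X\leq FX$ and $FFX\leq FX$, and comonads are dual. Finitely bicomplete means having all finite limits and colimits; $0$ and $1$ denote an initial and a terminal object. A weak factorization system is a pair $(\mathcal{L},\mathcal{R})$ of classes of morphisms such that every morphism factors as a map in $\mathcal{L}$ followed by a map in $\mathcal{R}$, $\mathcal{L}$ is the class of maps with the left lifting property with respect to $\mathcal{R}$, and $\mathcal{R}$ is the class of maps with the right lifting property with respect to $\mathcal{L}$. A model structure is a triple $(\mathrm{cof},\mathrm{we},\mathrm{fib})$ of retract-closed subcategories containing all objects (cofibrations, weak equivalences,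 fibrations) such that $(\mathrm{cof}\cap \mathrm{we},\mathrm{fib})$ and $(\mathrm{cof},\mathrm{we}\cap \mathrm{fib})$ are weak factorization systems and $\mathrm{we}$ has the two-out-of-three property. Maps in $\mathrm{cof}\cap\mathrm{we}$ are acyclic cofibrations; maps in $\mathrm{we}\cap\mathrm{fib}$ are acyclic fibrations. A model structure is strong if: whenever $g\circ f$ is an acyclic cofibration, $f$ is an acyclic cofibration; and whenever $g\circ f$ is an acyclic fibration, $g$ is an acyclic fibration. In a model structure on a preorder with $0$ and $1$, the fibrant replacement of $X$ is the object $FX$ (unique up to isomorphism) with $X\to FX$ an acyclic cofibration and $FX\to 1$ a fibration; the cofibrant replacement of $X$ is the object $CX$ with $0\to CX$ a cofibration and $CX\to X$ an acyclic fibration. These define the fibrant replacement monad and cofibrant replacement comonad. The bijection sends a strong model structure to the isomorphism class of its pair (fibrant replacement monad, cofibrant replacement comonad). *)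

theory Defs
  imports Main
begin

text \<open>
  The category is a type of class \<open>preorder\<close>. Since there is exactly one morphism
  \<open>x \<rightarrow> y\<close> if \<open>x \<le> y\<close> and none otherwise, a morphism is encoded as the pair
  \<open>(x, y)\<close>; diagrams commute and transformations are natural automatically, and these conditions
  are therefore not written out.
\<close>

definition isomorphic :: "'a::preorder \<Rightarrow> 'a \<Rightarrow> bool"  (infix "\<cong>" 50)
  where "x \<cong> y \<longleftrightarrow> x \<le> y \<and> y \<le> x"

definition initial :: "'a::preorder \<Rightarrow> bool"
  where "initial z \<longleftrightarrow> (\<forall>x. z \<le> x)"

definition terminal :: "'a::preorder \<Rightarrow> bool"
  where "terminal t \<longleftrightarrow> (\<forall>x. x \<le> t)"


subsection \<open>Finite limits and colimits\<close>

text \<open>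
  A functor from a finite category into a preorder depends only on the objects and on which of the
  hom-sets are inhabited. So a finite diagram has a finite set \<open>I\<close> of indices as objects, a
  preorder \<open>r\<close> on \<open>I\<close>, and an object map \<open>d\<close> monotone along \<open>r\<close>.
\<close>

definition finite_diagram :: "nat set \<Rightarrow> (nat \<times> nat) set \<Rightarrow> (nat \<Rightarrow> 'a::preorder) \<Rightarrow> bool"
  where "finite_diagram I r d \<longleftrightarrow> finite I \<and> preorder_on I r \<and> (\<forall>(i, j)\<in>r. d i \<le> d j)"

definition is_limit :: "nat set \<Rightarrow> (nat \<Rightarrow> 'a::preorder) \<Rightarrow> 'a \<Rightarrow> bool"
  where "is_limit I d x \<longleftrightarrow> (\<forall>i\<in>I. x \<le> d i) \<and> (\<forall>y. (\<forall>i\<in>I. y \<le> d i) \<longrightarrow> y \<le> x)"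

definition is_colimit :: "nat set \<Rightarrow> (nat \<Rightarrow> 'a::preorder) \<Rightarrow> 'a \<Rightarrow> bool"
  where "is_colimit I d x \<longleftrightarrow> (\<forall>i\<in>I. d i \<le> x) \<and> (\<forall>y. (\<forall>i\<in>I. d i \<le> y) \<longrightarrow> x \<le> y)"

definition finitely_bicomplete :: "'a::preorder itself \<Rightarrow> bool"
  where "finitely_bicomplete _ \<longleftrightarrow>
    (\<forall>I r (d :: nat \<Rightarrow> 'a). finite_diagram I r d \<longrightarrow> (\<exists>x. is_limit I d x) \<and> (\<exists>x. is_colimit I d x))"


subsection \<open>Monads and comonads\<close>

text \<open>The constant \<open>mono\<close> of the library needs antisymmetric orders.\<close>

definition monad :: "('a::preorder \<Rightarrow> 'a) \<Rightarrow> bool"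
  where "monad F \<longleftrightarrow> monotone (\<le>) (\<le>) F \<and> (\<forall>x. x \<le> F x) \<and> (\<forall>x. F (F x) \<le> F x)"

definition comonad :: "('a::preorder \<Rightarrow> 'a) \<Rightarrow> bool"
  where "comonad C \<longleftrightarrow> monotone (\<le>) (\<le>) C \<and> (\<forall>x. C x \<le> x) \<and> (\<forall>x. C x \<le> C (C x))"

definition idempotent :: "('a::preorder \<Rightarrow> 'a) \<Rightarrow> bool"
  where "idempotent T \<longleftrightarrow> (\<forall>x. T (T x) \<cong> T x)"


subsection \<open>Weak factorization systems\<close>

definition arrows :: "('a::preorder \<times> 'a) set"
  where "arrows = {(x, y). x \<le> y}"

definition has_lift :: "'a::preorder \<times> 'a \<Rightarrow> 'a \<times> 'a \<Rightarrow> bool"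
  where "has_lift f g \<longleftrightarrow> (fst f \<le> fst g \<and> snd f \<le> snd g \<longrightarrow> snd f \<le> fst g)"

definition left_lifting :: "('a::preorder \<times> 'a) set \<Rightarrow> ('a \<times> 'a) set"
  where "left_lifting R = {f \<in> arrows. \<forall>g\<in>R. has_lift f g}"

definition right_lifting :: "('a::preorder \<times> 'a) set \<Rightarrow> ('a \<times> 'a) set"
  where "right_lifting L = {g \<in> arrows. \<forall>f\<in>L. has_lift f g}"

definition weak_factorization_system :: "('a::preorder \<times> 'a) set \<Rightarrow> ('a \<times> 'a) set \<Rightarrow> bool"
  where "weak_factorization_system L R \<longleftrightarrow>
    (\<forall>(x, y)\<in>arrows. \<exists>z. (x, z) \<in> L \<and> (z, y) \<in> R) \<and>
    L = left_lifting R \<and> R = right_lifting L"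


subsection \<open>Model structures\<close>

definition wide_subcategory :: "('a::preorder \<times> 'a) set \<Rightarrow> bool"
  where "wide_subcategory S \<longleftrightarrow>
    S \<subseteq> arrows \<and> (\<forall>x. (x, x) \<in> S) \<and> (\<forall>x y z. (x, y) \<in> S \<longrightarrow> (y, z) \<in> S \<longrightarrow> (x, z) \<in> S)"

text \<open>Morphisms \<open>f \<rightarrow> g \<rightarrow> f\<close> in the arrow category; the composite is automatically the identity.\<close>

definition is_retract :: "'a::preorder \<times> 'a \<Rightarrow> 'a \<times> 'a \<Rightarrow> bool"
  where "is_retract f g \<longleftrightarrow>
    (fst f \<le> fst g \<and> snd f \<le> snd g) \<and> (fst g \<le> fst f \<and> snd g \<le> snd f)"

definition retract_closed :: "('a::preorder \<times> 'a) set \<Rightarrow> bool"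
  where "retract_closed S \<longleftrightarrow> (\<forall>g\<in>S. \<forall>f\<in>arrows. is_retract f g \<longrightarrow> f \<in> S)"

definition two_out_of_three :: "('a::preorder \<times> 'a) set \<Rightarrow> bool"
  where "two_out_of_three W \<longleftrightarrow>
    (\<forall>x y z. x \<le> y \<longrightarrow> y \<le> z \<longrightarrow>
      ((x, y) \<in> W \<and> (y, z) \<in> W \<longrightarrow> (x, z) \<in> W) \<and>
      ((x, y) \<in> W \<and> (x, z) \<in> W \<longrightarrow> (y, z) \<in> W) \<and>
      ((y, z) \<in> W \<and> (x, z) \<in> W \<longrightarrow> (x, y) \<in> W))"

record 'a model =
  cof :: "('a \<times> 'a) set"
  we :: "('a \<times> 'a) set"
  fib :: "('a \<times> 'a) set"

definition model_structure :: "'a::preorder model \<Rightarrow> bool"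
  where "model_structure M \<longleftrightarrow>
    (\<forall>S\<in>{cof M, we M, fib M}. wide_subcategory S \<and> retract_closed S) \<and>
    weak_factorization_system (cof M \<inter> we M) (fib M) \<and>
    weak_factorization_system (cof M) (we M \<inter> fib M) \<and>
    two_out_of_three (we M)"

definition strong_model_structure :: "'a::preorder model \<Rightarrow> bool"
  where "strong_model_structure M \<longleftrightarrow> model_structure M \<and>
    (\<forall>x y z. x \<le> y \<longrightarrow> y \<le> z \<longrightarrow> (x, z) \<in> cof M \<inter> we M \<longrightarrow> (x, y) \<in> cof M \<inter> we M) \<and>
    (\<forall>x y z. x \<le> y \<longrightarrow> y \<le> z \<longrightarrow> (x, z) \<in> we M \<inter> fib M \<longrightarrow> (y, z) \<in> we M \<inter> fib M)"


subsection \<open>Fibrant and cofibrant replacement\<close>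

text \<open>
  Replacements are unique only up to isomorphism, so these are relations between a model structure
  and a (co)monad; a monad isomorphic to a fibrant replacement monad is again one.
\<close>

definition fibrant_replacement :: "'a::preorder model \<Rightarrow> ('a \<Rightarrow> 'a) \<Rightarrow> bool"
  where "fibrant_replacement M F \<longleftrightarrow>
    (\<forall>x. (x, F x) \<in> cof M \<inter> we M \<and> (\<exists>t. terminal t \<and> (F x, t) \<in> fib M))"

definition cofibrant_replacement :: "'a::preorder model \<Rightarrow> ('a \<Rightarrow> 'a) \<Rightarrow> bool"
  where "cofibrant_replacement M C \<longleftrightarrow>
    (\<forall>x. (\<exists>z. initial z \<and> (z, C x) \<in> cof M) \<and> (C x, x) \<in> we M \<inter> fib M)"


subsection \<open>Monad-comonad pairs\<close>

definition condition_i :: "('a::preorder \<Rightarrow> 'a) \<Rightarrow> ('a \<Rightarrow> 'a) \<Rightarrow> bool"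
  where "condition_i F C \<longleftrightarrow>
    idempotent F \<and> idempotent C \<and> (\<forall>x. F (C x) \<cong> C (F x)) \<and>
    (\<forall>x y. x \<le> C y \<and> F x \<le> y \<longrightarrow> F x \<le> C y)"

definition condition_ii :: "('a::preorder \<Rightarrow> 'a) \<Rightarrow> ('a \<Rightarrow> 'a) \<Rightarrow> bool"
  where "condition_ii F C \<longleftrightarrow> (\<forall>a b. a \<le> b \<and> C b \<le> C a \<and> F b \<le> F a \<longrightarrow> b \<le> a)"

definition admissible_pairs :: "(('a::preorder \<Rightarrow> 'a) \<times> ('a \<Rightarrow> 'a)) set"
  where "admissible_pairs =
    {(F, C). monad F \<and> comonad C \<and> condition_i F C \<and> condition_ii F C}"

definition pair_iso :: "((('a::preorder \<Rightarrow> 'a) \<times> ('a \<Rightarrow> 'a)) \<times> (('a \<Rightarrow> 'a) \<times> ('a \<Rightarrow> 'a))) set"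
  where "pair_iso = {((F, C), (F', C')).
    (F, C) \<in> admissible_pairs \<and> (F', C') \<in> admissible_pairs \<and>
    (\<forall>x. F x \<cong> F' x) \<and> (\<forall>x. C x \<cong> C' x)}"

text \<open>
  The isomorphism class of the pair (fibrant replacement monad, cofibrant replacement comonad),
  given as the set of all pairs that arise from some choice of replacements.
\<close>

definition replacement_class ::
    "'a::preorder model \<Rightarrow> (('a \<Rightarrow> 'a) \<times> ('a \<Rightarrow> 'a)) set"
  where "replacement_class M =
    {(F, C). monad F \<and> comonad C \<and> fibrant_replacement M F \<and> cofibrant_replacement M C}"

end

theory Submission
  imports Defs
begin

text \<open>
  In a strong model structure a map \<open>x \<rightarrow> y\<close> is an acyclic cofibration iff \<open>y \<le> F x\<close>: lift against
  the fibration from \<open>F x\<close> to the terminal object, respectively cancel in \<open>x \<rightarrow> y \<rightarrow> F x\<close>. Dually, it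
  is an acyclic fibration iff \<open>C y \<le> x\<close>. These two classes determine the model structure; factoring
  through \<open>x \<squnion> C y\<close> shows that the weak equivalences are the maps with \<open>C y \<le> F x\<close>, while the
  fibrations are those with \<open>y \<sqinter> F x \<le> x\<close> and the cofibrations those with \<open>y \<le> x \<squnion> C y\<close>.
  Conversely, these formulas give a model structure: each of the two weak factorization
  systems exists for any (co)monad, commutation of \<open>F\<close> and \<open>C\<close> makes weak equivalences compose,
  and condition (ii), applied to \<open>x \<squnion> C y \<le> y\<close> and to \<open>x \<le> y \<sqinter> F x\<close>, puts
  the acyclic (co)fibrations among the (co)fibrations.
\<close>

subsection \<open>Finite limits and colimits in a preorder\<close>

text \<open>Discrete diagrams, on no index and on two indices, supply the terminal and initial
  objects and binary meets and joins.\<close>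

lemma finite_diagram_Id_on: "finite I \<Longrightarrow> finite_diagram I (Id_on I) d"
  by (auto simp: finite_diagram_def preorder_on_def refl_on_def trans_def Id_on_def)

context
  assumes bicomplete: "finitely_bicomplete TYPE('a::preorder)"
begin

lemma terminal_exists: "\<exists>t::'a. terminal t"
proof -
  obtain t :: 'a where "is_limit {} undefined t"
    using bicomplete finite_diagram_Id_on[of "{}"] unfolding finitely_bicomplete_def by blast
  then show ?thesis by (auto simp: is_limit_def terminal_def)
qed

lemma initial_exists: "\<exists>z::'a. initial z"
proof -
  obtain z :: 'a where "is_colimit {} undefined z"
    using bicomplete finite_diagram_Id_on[of "{}"] unfolding finitely_bicomplete_def by blast
  then show ?thesis by (auto simp: is_colimit_def initial_def)
qed

lemma meet_exists:
  fixes a b :: 'a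
  obtains m where "m \<le> a" "m \<le> b" "\<And>w. w \<le> a \<Longrightarrow> w \<le> b \<Longrightarrow> w \<le> m"
proof -
  obtain m where m: "is_limit {0, 1} (\<lambda>i::nat. if i = 0 then a else b) m"
    using bicomplete finite_diagram_Id_on[of "{0, 1}"] unfolding finitely_bicomplete_def by blast
  show thesis by (rule that[of m]) (use m in \<open>simp_all add: is_limit_def\<close>)
qed

lemma join_exists:
  fixes a b :: 'a
  obtains j where "a \<le> j" "b \<le> j" "\<And>w. a \<le> w \<Longrightarrow> b \<le> w \<Longrightarrow> j \<le> w"
proof -
  obtain j where j: "is_colimit {0, 1} (\<lambda>i::nat. if i = 0 then a else b) j"
    using bicomplete finite_diagram_Id_on[of "{0, 1}"] unfolding finitely_bicomplete_def by blast
  show thesis by (rule that[of j]) (use j in \<open>simp_all add: is_colimit_def\<close>)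
qed

end


subsection \<open>The weak factorization system of a monad or comonad\<close>

definition monad_acyclic :: "('a::preorder \<Rightarrow> 'a) \<Rightarrow> ('a \<times> 'a) set"
  where "monad_acyclic F = {(x, y). x \<le> y \<and> y \<le> F x}"

definition comonad_acyclic :: "('a::preorder \<Rightarrow> 'a) \<Rightarrow> ('a \<times> 'a) set"
  where "comonad_acyclic C = {(x, y). x \<le> y \<and> C y \<le> x}"

text \<open>
  The conditions \<open>y \<sqinter> F x \<le> x\<close> and \<open>y \<le> x \<squnion> C y\<close>, stated without a choice of meets and joins.
\<close>

definition monad_fib :: "('a::preorder \<Rightarrow> 'a) \<Rightarrow> ('a \<times> 'a) set"
  where "monad_fib F = {(x, y). x \<le> y \<and> (\<forall>w. w \<le> y \<longrightarrow> w \<le> F x \<longrightarrow> w \<le> x)}"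

definition comonad_cof :: "('a::preorder \<Rightarrow> 'a) \<Rightarrow> ('a \<times> 'a) set"
  where "comonad_cof C = {(x, y). x \<le> y \<and> (\<forall>w. x \<le> w \<longrightarrow> C y \<le> w \<longrightarrow> y \<le> w)}"

lemma monadD:
  assumes "monad F"
  shows "x \<le> y \<Longrightarrow> F x \<le> F y" "x \<le> F x" "F (F x) \<le> F x"
  using assms by (auto simp: monad_def monotone_def)

lemma comonadD:
  assumes "comonad C"
  shows "x \<le> y \<Longrightarrow> C x \<le> C y" "C x \<le> x" "C x \<le> C (C x)"
  using assms by (auto simp: comonad_def monotone_def)

section \<open>Weak factorization systems in a preorder\<close>

lemma wfs_left_eq: "weak_factorization_system L R \<Longrightarrow> L = left_lifting R"
  and wfs_right_eq: "weak_factorization_system L R \<Longrightarrow> R = right_lifting L"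
  unfolding weak_factorization_system_def by blast+

lemma wfs_lift:
  assumes "weak_factorization_system L R" "(a, b) \<in> L" "(c, d) \<in> R" "a \<le> c" "b \<le> d"
  shows "b \<le> c"
proof -
  have "(a, b) \<in> left_lifting R" using wfs_left_eq[OF assms(1)] assms(2) by blast
  then have "has_lift (a, b) (c, d)" using assms(3) by (simp add: left_lifting_def)
  then show ?thesis using assms(4,5) by (simp add: has_lift_def)
qed

lemma wfs_factor:
  assumes "weak_factorization_system L R" "x \<le> y"
  obtains z where "(x, z) \<in> L" "(z, y) \<in> R"
proof -
  have "\<forall>(x, y)\<in>arrows. \<exists>z. (x, z) \<in> L \<and> (z, y) \<in> R"
    using assms(1) unfolding weak_factorization_system_def by (rule conjunct1)
  moreover have "(x, y) \<in> arrows" using assms(2) by (simp add: arrows_def)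
  ultimately show thesis using that by blast
qed

text \<open>This is the retract argument: a map with the lifting property lifts against the other
  half of its own factorization, so the middle object is isomorphic to one of its endpoints. Closure
  under isomorphic endpoints then puts the map into the class.\<close>

lemma wfsI:
  assumes "L \<subseteq> arrows" "R \<subseteq> arrows"
    and lift: "\<And>a b c d. (a, b) \<in> L \<Longrightarrow> (c, d) \<in> R \<Longrightarrow> a \<le> c \<Longrightarrow> b \<le> d \<Longrightarrow> b \<le> c"
    and factor: "\<And>x y. x \<le> y \<Longrightarrow> \<exists>z. (x, z) \<in> L \<and> (z, y) \<in> R"
    and left_retract: "\<And>x y z. (x, z) \<in> L \<Longrightarrow> x \<le> y \<Longrightarrow> y \<le> z \<Longrightarrow> z \<le> y \<Longrightarrow> (x, y) \<in> L"
    and right_retract: "\<And>x y z. (z, y) \<in> R \<Longrightarrow> x \<le> y \<Longrightarrow> x \<le> z \<Longrightarrow> z \<le> x \<Longrightarrow> (x, y) \<in> R"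
  shows "weak_factorization_system L R"
proof -
  have arrow: "(x, y) \<in> L \<Longrightarrow> x \<le> y" "(x, y) \<in> R \<Longrightarrow> x \<le> y" for x y
    using assms(1,2) by (auto simp: arrows_def)
  have "(x, y) \<in> L" if "(x, y) \<in> left_lifting R" for x y
  proof -
    have "x \<le> y" using that by (simp add: left_lifting_def arrows_def)
    moreover obtain z where "(x, z) \<in> L" "(z, y) \<in> R" using factor[OF \<open>x \<le> y\<close>] by blast
    moreover have "y \<le> z"
      using that calculation arrow by (force simp: left_lifting_def has_lift_def)
    ultimately show ?thesis using left_retract arrow by blast
  qed
  moreover have "(x, y) \<in> R" if "(x, y) \<in> right_lifting L" for x y
  proof -
    have "x \<le> y" using that by (simp add: right_lifting_def arrows_def)
    moreover obtain z where "(x, z) \<in> L" "(z, y) \<in> R" using factor[OF \<open>x \<le> y\<close>] by blast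
    moreover have "z \<le> x"
      using that calculation arrow by (force simp: right_lifting_def has_lift_def)
    ultimately show ?thesis using right_retract arrow by blast
  qed
  moreover have "L \<subseteq> left_lifting R" "R \<subseteq> right_lifting L"
    using assms(1,2) lift by (auto simp: left_lifting_def right_lifting_def has_lift_def)
  moreover have "\<forall>(x, y)\<in>arrows. \<exists>z. (x, z) \<in> L \<and> (z, y) \<in> R"
    using factor by (auto simp: arrows_def)
  ultimately show ?thesis unfolding weak_factorization_system_def by auto
qed

text \<open>The middle object for \<open>x \<le> y\<close> is the meet of \<open>y\<close> and
  \<open>F x\<close>. For a lift, \<open>b \<le> F a \<le> F c\<close> and \<open>b \<le> d\<close>
  put \<open>b\<close> among the \<open>w\<close> tested by \<open>monad_fib\<close>.\<close>

lemma wfs_monad: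
  fixes F :: "'a::preorder \<Rightarrow> 'a"
  assumes "finitely_bicomplete TYPE('a)" "monad F"
  shows "weak_factorization_system (monad_acyclic F) (monad_fib F)"
proof (rule wfsI)
  note F = monadD[OF assms(2)]
  fix x y z a b c d :: 'a
  show "b \<le> c" if "(a, b) \<in> monad_acyclic F" "(c, d) \<in> monad_fib F" "a \<le> c" "b \<le> d"
    using that F(1)[of a c] by (auto simp: monad_acyclic_def monad_fib_def intro: order_trans)
  show "(x, y) \<in> monad_acyclic F"
    if "(x, z) \<in> monad_acyclic F" "x \<le> y" "y \<le> z" "z \<le> y"
    using that by (auto simp: monad_acyclic_def intro: order_trans)
  show "(x, y) \<in> monad_fib F"
    if "(z, y) \<in> monad_fib F" "x \<le> y" "x \<le> z" "z \<le> x"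
    using that F(1)[of x z] by (auto simp: monad_fib_def intro: order_trans)
  show "\<exists>z. (x, z) \<in> monad_acyclic F \<and> (z, y) \<in> monad_fib F" if "x \<le> y"
  proof -
    obtain m where m: "m \<le> y" "m \<le> F x" "\<And>w. w \<le> y \<Longrightarrow> w \<le> F x \<Longrightarrow> w \<le> m"
      using meet_exists[OF assms(1)] by metis
    have "F m \<le> F x" using F(1)[OF m(2)] F(3) order_trans by blast
    then have "(m, y) \<in> monad_fib F" using m by (auto simp: monad_fib_def intro: order_trans)
    moreover have "(x, m) \<in> monad_acyclic F" using m F(2) that by (auto simp: monad_acyclic_def)
    ultimately show ?thesis by blast
  qed
qed (auto simp: monad_acyclic_def monad_fib_def arrows_def)

text \<open>Dual, with the join of \<open>x\<close> and \<open>C y\<close> as middle object.\<close>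

lemma wfs_comonad:
  fixes C :: "'a::preorder \<Rightarrow> 'a"
  assumes "finitely_bicomplete TYPE('a)" "comonad C"
  shows "weak_factorization_system (comonad_cof C) (comonad_acyclic C)"
proof (rule wfsI)
  note C = comonadD[OF assms(2)]
  fix x y z a b c d :: 'a
  show "b \<le> c" if "(a, b) \<in> comonad_cof C" "(c, d) \<in> comonad_acyclic C" "a \<le> c" "b \<le> d"
    using that C(1)[of b d] by (auto simp: comonad_acyclic_def comonad_cof_def intro: order_trans)
  show "(x, y) \<in> comonad_cof C"
    if "(x, z) \<in> comonad_cof C" "x \<le> y" "y \<le> z" "z \<le> y"
    using that C(1)[of z y] by (auto simp: comonad_cof_def intro: order_trans)
  show "(x, y) \<in> comonad_acyclic C"
    if "(z, y) \<in> comonad_acyclic C" "x \<le> y" "x \<le> z" "z \<le> x"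
    using that by (auto simp: comonad_acyclic_def intro: order_trans)
  show "\<exists>z. (x, z) \<in> comonad_cof C \<and> (z, y) \<in> comonad_acyclic C" if "x \<le> y"
  proof -
    obtain j where j: "x \<le> j" "C y \<le> j" "\<And>w. x \<le> w \<Longrightarrow> C y \<le> w \<Longrightarrow> j \<le> w"
      using join_exists[OF assms(1)] by metis
    have "C y \<le> C j" using C(1)[OF j(2)] C(3) order_trans by blast
    then have "(x, j) \<in> comonad_cof C" using j by (auto simp: comonad_cof_def intro: order_trans)
    moreover have "(j, y) \<in> comonad_acyclic C"
      using j C(2) that by (auto simp: comonad_acyclic_def)
    ultimately show ?thesis by blast
  qed
qed (auto simp: comonad_acyclic_def comonad_cof_def arrows_def)


subsection \<open>The model structure of an admissible pair\<close>

definition model_of :: "('a::preorder \<Rightarrow> 'a) \<Rightarrow> ('a \<Rightarrow> 'a) \<Rightarrow> 'a model"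
  where "model_of F C =
    \<lparr>cof = comonad_cof C, we = {(x, y). x \<le> y \<and> C y \<le> F x}, fib = monad_fib F\<rparr>"

context
  fixes F C :: "'a::preorder \<Rightarrow> 'a"
  assumes bicomplete: "finitely_bicomplete TYPE('a)"
    and monad: "monad F" and comonad: "comonad C"
    and commute: "\<And>x. C (F x) \<le> F (C x)"
    and cond_ii: "condition_ii F C"
begin

text \<open>The join \<open>j\<close> of \<open>x\<close> and \<open>C y\<close> lies below
  \<open>y\<close>, and when \<open>y \<le> F x\<close> both \<open>C y \<le> C j\<close> and
  \<open>F y \<le> F j\<close> hold. Condition (ii) then forces \<open>y \<le> j\<close>, so
  \<open>(x, y)\<close> is a cofibration.\<close>

lemma model_of_acyclic_cof: "cof (model_of F C) \<inter> we (model_of F C) = monad_acyclic F"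
proof -
  note F = monadD[OF monad] and C = comonadD[OF comonad]
  \<comment> \<open>The universal condition is used at \<open>w = F x\<close>.\<close>
  have 1: "y \<le> F x" if "\<forall>w. x \<le> w \<longrightarrow> C y \<le> w \<longrightarrow> y \<le> w" "C y \<le> F x" for x y
    using that F(2) by blast
  have 2: "y \<le> w" if "x \<le> y" "y \<le> F x" "x \<le> w" "C y \<le> w" for x y w
  proof -
    obtain j where j: "x \<le> j" "C y \<le> j" "\<And>w. x \<le> w \<Longrightarrow> C y \<le> w \<Longrightarrow> j \<le> w"
      using join_exists[OF bicomplete] by metis
    have "C y \<le> C j" using C(1)[OF j(2)] C(3) order_trans by blast
    moreover have "F y \<le> F j"
      using F(1)[OF that(2)] F(3)[of x] F(1)[OF j(1)] order_trans by blast
    moreover have "j \<le> y" using j(3) that(1) C(2) by blast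
    ultimately have "y \<le> j" using cond_ii unfolding condition_ii_def by blast
    then show ?thesis using j(3)[OF that(3,4)] order_trans by blast
  qed
  have 3: "C y \<le> F x" if "y \<le> F x" for x y
    using that C(2) order_trans by blast
  show ?thesis
    unfolding model_of_def monad_acyclic_def comonad_cof_def
    by (simp add: set_eq_iff) (use 1 2 3 in blast)
qed

lemma model_of_acyclic_fib: "we (model_of F C) \<inter> fib (model_of F C) = comonad_acyclic C"
proof -
  note F = monadD[OF monad] and C = comonadD[OF comonad]
  \<comment> \<open>Here the universal condition is used at \<open>w = C y\<close>.\<close>
  have 1: "C y \<le> x" if "\<forall>w. w \<le> y \<longrightarrow> w \<le> F x \<longrightarrow> w \<le> x" "C y \<le> F x" for x y
    using that C(2) by blast
  have 2: "w \<le> x" if "x \<le> y" "C y \<le> x" "w \<le> y" "w \<le> F x" for x y w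
  proof -
    obtain m where m: "m \<le> y" "m \<le> F x" "\<And>w. w \<le> y \<Longrightarrow> w \<le> F x \<Longrightarrow> w \<le> m"
      using meet_exists[OF bicomplete] by metis
    have "F m \<le> F x" using F(1)[OF m(2)] F(3) order_trans by blast
    moreover have "C m \<le> C x"
      using C(1)[OF m(1)] C(3)[of y] C(1)[OF that(2)] order_trans by blast
    moreover have "x \<le> m" using m(3) that(1) F(2) by blast
    ultimately have "m \<le> x" using cond_ii unfolding condition_ii_def by blast
    then show ?thesis using m(3)[OF that(3,4)] order_trans by blast
  qed
  have 3: "C y \<le> F x" if "C y \<le> x" for x y
    using that F(2) order_trans by blast
  show ?thesis
    unfolding model_of_def comonad_acyclic_def monad_fib_def
    by (simp add: set_eq_iff) (use 1 2 3 in blast)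
qed

text \<open>Both cancellation laws come from monotonicity, applied to the inequality for the
  composite. Closure under composition is where \<open>C\<close> has to be moved past
  \<open>F\<close>.\<close>

lemma model_of_two_out_of_three: "two_out_of_three (we (model_of F C))"
proof -
  note F = monadD[OF monad] and C = comonadD[OF comonad]
  have 1: "C z \<le> F x" if "C y \<le> F x" "C z \<le> F y" for x y z
  proof -
    have "C z \<le> C (C z)" by (rule C(3))
    also have "\<dots> \<le> C (F y)" by (rule C(1)[OF that(2)])
    also have "\<dots> \<le> F (C y)" by (rule commute)
    also have "\<dots> \<le> F (F x)" by (rule F(1)[OF that(1)])
    also have "\<dots> \<le> F x" by (rule F(3))
    finally show ?thesis .
  qed
  have 2: "C z \<le> F y" if "x \<le> y" "C z \<le> F x" for x y z
    using order_trans[OF that(2) F(1)[OF that(1)]] .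
  have 3: "C y \<le> F x" if "y \<le> z" "C z \<le> F x" for x y z
    using order_trans[OF C(1)[OF that(1)] that(2)] .
  show ?thesis
    unfolding two_out_of_three_def
    by (simp add: model_of_def) (metis 1 2 3 order_trans)
qed

text \<open>With the acyclic classes identified, the two factorization systems are those of
  \<open>F\<close> and of \<open>C\<close>. Strength is read off the formulas:
  \<open>y \<le> z \<le> F x\<close> in one case, \<open>C z \<le> x \<le> y\<close> in the
  other.\<close>

lemma strong_model_of: "strong_model_structure (model_of F C)"
proof -
  note F = monadD[OF monad] and C = comonadD[OF comonad]
  have we_refl: "C x \<le> F x" for x using order_trans[OF C(2) F(2)] .
  have we_retract: "C y \<le> F x" if "C b \<le> F a" "y \<le> b" "a \<le> x" for a b x y
    using order_trans[OF C(1)[OF that(2)] order_trans[OF that(1) F(1)[OF that(3)]]] .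
  have we_trans: "(x, z) \<in> we (model_of F C)"
    if "(x, y) \<in> we (model_of F C)" "(y, z) \<in> we (model_of F C)" for x y z
    using that model_of_two_out_of_three unfolding two_out_of_three_def model_of_def by auto
  have "wide_subcategory (we (model_of F C))"
    unfolding wide_subcategory_def
  proof (intro conjI allI impI)
    show "we (model_of F C) \<subseteq> arrows" by (auto simp: model_of_def arrows_def)
    show "(x, x) \<in> we (model_of F C)" for x by (simp add: model_of_def we_refl)
  qed (rule we_trans)
  moreover have "retract_closed (we (model_of F C))"
    unfolding retract_closed_def is_retract_def arrows_def model_of_def
    by clarsimp (rule we_retract)
  \<comment> \<open>For a composite of \<open>(x, y)\<close> and \<open>(y, z)\<close> and an upper
    bound \<open>w\<close> of \<open>x\<close> and \<open>C z\<close>, monotonicity gives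
    \<open>C y \<le> C z \<le> w\<close>, so \<open>w\<close> lies above \<open>y\<close> and then
    above \<open>z\<close>.\<close>
  moreover have "wide_subcategory (comonad_cof C)"
    unfolding wide_subcategory_def arrows_def comonad_cof_def
    by (simp add: subset_iff) (meson C(1) order_trans)
  moreover have "wide_subcategory (monad_fib F)"
    unfolding wide_subcategory_def arrows_def monad_fib_def
    by (simp add: subset_iff) (meson F(1) order_trans)
  moreover have "retract_closed (comonad_cof C)"
    unfolding retract_closed_def is_retract_def arrows_def comonad_cof_def
    by clarsimp (meson C(1) order_trans)
  moreover have "retract_closed (monad_fib F)"
    unfolding retract_closed_def is_retract_def arrows_def monad_fib_def
    by clarsimp (meson F(1) order_trans)
  moreover have "weak_factorization_system (monad_acyclic F) (fib (model_of F C))"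
    "weak_factorization_system (cof (model_of F C)) (comonad_acyclic C)"
    using wfs_monad[OF bicomplete monad] wfs_comonad[OF bicomplete comonad]
    by (simp_all add: model_of_def)
  moreover have "cof (model_of F C) = comonad_cof C" "fib (model_of F C) = monad_fib F"
    by (simp_all add: model_of_def)
  ultimately have "model_structure (model_of F C)"
    using model_of_two_out_of_three
    unfolding model_structure_def model_of_acyclic_cof model_of_acyclic_fib by simp
  then show ?thesis
    unfolding strong_model_structure_def model_of_acyclic_cof model_of_acyclic_fib
    unfolding monad_acyclic_def comonad_acyclic_def
    by simp (meson order_trans)
qed

text \<open>\<open>F x\<close> is fibrant because \<open>w \<le> F (F x)\<close> already implies
  \<open>w \<le> F x\<close>.\<close>

lemma fibrant_replacement_model_of: "fibrant_replacement (model_of F C) F"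
proof -
  note F = monadD[OF monad]
  obtain t :: 'a where "terminal t" using terminal_exists[OF bicomplete] by blast
  moreover have "(F x, t) \<in> fib (model_of F C)" for x
    using \<open>terminal t\<close>
    by (auto simp: model_of_def monad_fib_def terminal_def intro: order_trans[OF _ F(3)])
  ultimately show ?thesis
    using F(2) unfolding fibrant_replacement_def model_of_acyclic_cof
    by (auto simp: monad_acyclic_def)
qed

lemma cofibrant_replacement_model_of: "cofibrant_replacement (model_of F C) C"
proof -
  note C = comonadD[OF comonad]
  obtain z :: 'a where "initial z" using initial_exists[OF bicomplete] by blast
  moreover have "(z, C x) \<in> cof (model_of F C)" for x
    using \<open>initial z\<close>
    by (auto simp: model_of_def comonad_cof_def initial_def intro: order_trans[OF C(3)])
  ultimately show ?thesis
    using C(2) unfolding cofibrant_replacement_def model_of_acyclic_fib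
    by (auto simp: comonad_acyclic_def)
qed

end


subsection \<open>Replacements in a strong model structure\<close>

context
  fixes M :: "'a::preorder model"
  assumes strong: "strong_model_structure M"
begin

lemma model: "model_structure M"
  using strong unfolding strong_model_structure_def by (rule conjunct1)

lemma wfs_acyclic_cof: "weak_factorization_system (cof M \<inter> we M) (fib M)"
  and wfs_acyclic_fib: "weak_factorization_system (cof M) (we M \<inter> fib M)"
  and model_wide_subcategory:
    "wide_subcategory (cof M)" "wide_subcategory (we M)" "wide_subcategory (fib M)"
  and model_retract_closed: "S \<in> {cof M, we M, fib M} \<Longrightarrow> retract_closed S"
  and model_two_out_of_three: "two_out_of_three (we M)"
  using model by (auto simp: model_structure_def)

lemma wide_subcategoryD:
  assumes "wide_subcategory S"
  shows "(x, y) \<in> S \<Longrightarrow> x \<le> y" "(x, y) \<in> S \<Longrightarrow> (y, z) \<in> S \<Longrightarrow> (x, z) \<in> S"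
  using assms unfolding wide_subcategory_def arrows_def by blast+

lemmas model_arrow = model_wide_subcategory[THEN wide_subcategoryD(1)]
lemmas model_comp = model_wide_subcategory[THEN wide_subcategoryD(2)]

lemma we_cancel_left:
  assumes "x \<le> y" "y \<le> z" "(x, y) \<in> we M" "(x, z) \<in> we M"
  shows "(y, z) \<in> we M"
  using model_two_out_of_three assms unfolding two_out_of_three_def by blast

lemma we_cancel_right:
  assumes "x \<le> y" "y \<le> z" "(y, z) \<in> we M" "(x, z) \<in> we M"
  shows "(x, y) \<in> we M"
  using model_two_out_of_three assms unfolding two_out_of_three_def by blast

lemma acyclic_cof_cancel:
  assumes "x \<le> y" "y \<le> z" "(x, z) \<in> cof M \<inter> we M"
  shows "(x, y) \<in> cof M \<inter> we M"
  using strong assms unfolding strong_model_structure_def by fast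

lemma acyclic_fib_cancel:
  assumes "x \<le> y" "y \<le> z" "(x, z) \<in> we M \<inter> fib M"
  shows "(y, z) \<in> we M \<inter> fib M"
  using strong assms unfolding strong_model_structure_def by fast

text \<open>Between arrows of a preorder, a retract is the same as an isomorphism, so retract
  closure allows endpoints to be exchanged for isomorphic ones.\<close>

lemma model_retract:
  assumes "S \<in> {cof M, we M, fib M}" "(a, b) \<in> S" "x \<cong> a" "y \<cong> b" "x \<le> y"
  shows "(x, y) \<in> S"
  using model_retract_closed[OF assms(1)] assms(2-)
  unfolding retract_closed_def is_retract_def isomorphic_def arrows_def by force

text \<open>The desired inequality is the lift of \<open>(x, y)\<close> against the fibration from
  \<open>F a\<close> to the terminal object. Uniqueness of replacements and the monad laws both rest
  on it.\<close>

lemma fibrant_replacement_least: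
  assumes "fibrant_replacement M F" "(x, y) \<in> cof M \<inter> we M" "x \<le> F a"
  shows "y \<le> F a"
proof -
  obtain t where "terminal t" "(F a, t) \<in> fib M"
    using assms(1) by (auto simp: fibrant_replacement_def)
  then show ?thesis
    using wfs_lift[OF wfs_acyclic_cof assms(2)] assms(3) by (simp add: terminal_def)
qed

lemma cofibrant_replacement_greatest:
  assumes "cofibrant_replacement M C" "(x, y) \<in> we M \<inter> fib M" "C a \<le> y"
  shows "C a \<le> x"
proof -
  obtain z where "initial z" "(z, C a) \<in> cof M"
    using assms(1) by (auto simp: cofibrant_replacement_def)
  then show ?thesis
    using wfs_lift[OF wfs_acyclic_fib _ assms(2)] assms(3) by (simp add: initial_def)
qed

lemma fibrant_replacement_acyclic:
  assumes "fibrant_replacement M F"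
  shows "(x, F x) \<in> cof M" "(x, F x) \<in> we M" "x \<le> F x"
  using assms model_arrow by (auto simp: fibrant_replacement_def)

lemma cofibrant_replacement_acyclic:
  assumes "cofibrant_replacement M C"
  shows "(C x, x) \<in> we M" "(C x, x) \<in> fib M" "C x \<le> x"
  using assms model_arrow by (auto simp: cofibrant_replacement_def)

text \<open>By \<open>L\<close>, \<open>x \<le> F a\<close> implies \<open>F x \<le> F a\<close>.
  Together with \<open>x \<le> F x\<close> this characterizes closure operators; monotonicity and
  the multiplication are instances.\<close>

lemma fibrant_replacement_monad:
  assumes "fibrant_replacement M F"
  shows "monad F"
proof -
  note R = fibrant_replacement_acyclic[OF assms]
  note L = fibrant_replacement_least[OF assms IntI[OF R(1,2)]]
  have "F x \<le> F y" if "x \<le> y" for x y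
    using L order_trans[OF that R(3)] .
  moreover have "F (F x) \<le> F x" for x
    using L by simp
  ultimately show ?thesis using R(3) by (simp add: monad_def monotone_def)
qed

lemma cofibrant_replacement_comonad:
  assumes "cofibrant_replacement M C"
  shows "comonad C"
proof -
  note R = cofibrant_replacement_acyclic[OF assms]
  note L = cofibrant_replacement_greatest[OF assms IntI[OF R(1,2)]]
  have "C x \<le> C y" if "x \<le> y" for x y
    using L order_trans[OF R(3) that] .
  moreover have "C x \<le> C (C x)" for x
    using L by simp
  ultimately show ?thesis using R(3) by (simp add: comonad_def monotone_def)
qed

text \<open>Strength gives the inclusion of \<open>monad_acyclic F\<close>: if
  \<open>y \<le> F x\<close>, then \<open>(x, y)\<close> is the first factor of the acyclic
  cofibration \<open>(x, F x)\<close>.\<close>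

lemma acyclic_cof_eq:
  assumes "fibrant_replacement M F"
  shows "cof M \<inter> we M = monad_acyclic F"
proof -
  note R = fibrant_replacement_acyclic[OF assms]
  show ?thesis
  proof (intro subset_antisym subrelI)
    fix x y
    show "(x, y) \<in> monad_acyclic F" if "(x, y) \<in> cof M \<inter> we M"
      using fibrant_replacement_least[OF assms that R(3)] that model_arrow(2)
      by (simp add: monad_acyclic_def)
    show "(x, y) \<in> cof M \<inter> we M" if "(x, y) \<in> monad_acyclic F"
      using acyclic_cof_cancel[of x y "F x"] R(1,2)[of x] that by (simp add: monad_acyclic_def)
  qed
qed

lemma acyclic_fib_eq:
  assumes "cofibrant_replacement M C"
  shows "we M \<inter> fib M = comonad_acyclic C"
proof -
  note R = cofibrant_replacement_acyclic[OF assms]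
  show ?thesis
  proof (intro subset_antisym subrelI)
    fix x y
    show "(x, y) \<in> comonad_acyclic C" if "(x, y) \<in> we M \<inter> fib M"
      using cofibrant_replacement_greatest[OF assms that R(3)] that model_arrow(2)
      by (simp add: comonad_acyclic_def)
    show "(x, y) \<in> we M \<inter> fib M" if "(x, y) \<in> comonad_acyclic C"
      using acyclic_fib_cancel[of "C y" x y] R(1,2)[of y] that by (simp add: comonad_acyclic_def)
  qed
qed

section \<open>Recovering the model structure and the conditions from a pair of replacements\<close>

context
  fixes F C
  assumes bicomplete: "finitely_bicomplete TYPE('a)"
    and fibrant: "fibrant_replacement M F" and cofibrant: "cofibrant_replacement M C"
begin

lemma we_eq: "we M = {(x, y). x \<le> y \<and> C y \<le> F x}"
proof -
  note F = monadD[OF fibrant_replacement_monad[OF fibrant]]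
  note C = comonadD[OF cofibrant_replacement_comonad[OF cofibrant]]
  have "C y \<le> F x" if xy: "(x, y) \<in> we M" for x y
  proof -
    obtain z where z: "(x, z) \<in> cof M \<inter> we M" "(z, y) \<in> fib M"
      using wfs_factor[OF wfs_acyclic_cof model_arrow(2)[OF xy]] .
    \<comment> \<open>Two-out-of-three makes the second factor an acyclic fibration, so that
      \<open>C y \<le> z \<le> F x\<close>.\<close>
    then have "(z, y) \<in> we M"
      using we_cancel_left[OF _ _ _ xy] model_arrow by blast
    then have "C y \<le> z"
      using cofibrant_replacement_greatest[OF cofibrant, of z y y] z C(2) by blast
    moreover have "z \<le> F x"
      using fibrant_replacement_least[OF fibrant z(1)] F(2) by blast
    ultimately show ?thesis by (rule order_trans)
  qed
  moreover have "(x, y) \<in> we M" if "x \<le> y" "C y \<le> F x" for x y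
  proof -
    obtain j where j: "x \<le> j" "C y \<le> j" "\<And>w. x \<le> w \<Longrightarrow> C y \<le> w \<Longrightarrow> j \<le> w"
      using join_exists[OF bicomplete] by metis
    have "(x, j) \<in> monad_acyclic F" using j that F(2) by (simp add: monad_acyclic_def)
    moreover have "(j, y) \<in> comonad_acyclic C" using j that C(2) by (simp add: comonad_acyclic_def)
    ultimately show ?thesis
      using model_comp(2) acyclic_cof_eq[OF fibrant] acyclic_fib_eq[OF cofibrant] by blast
  qed
  ultimately show ?thesis using model_arrow(2) by (intro subset_antisym subrelI) blast+
qed

text \<open>Fibrations and cofibrations are the lifting complements of the acyclic classes, which
  \<open>F\<close> and \<open>C\<close> determine.\<close>

lemma strong_model_eq_model_of: "M = model_of F C"
proof (rule model.equality)
  show "fib M = fib (model_of F C)"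
    using wfs_right_eq[OF wfs_acyclic_cof] acyclic_cof_eq[OF fibrant]
      wfs_right_eq[OF wfs_monad[OF bicomplete fibrant_replacement_monad[OF fibrant]]]
    by (simp add: model_of_def)
  show "cof M = cof (model_of F C)"
    using wfs_left_eq[OF wfs_acyclic_fib] acyclic_fib_eq[OF cofibrant]
      wfs_left_eq[OF wfs_comonad[OF bicomplete cofibrant_replacement_comonad[OF cofibrant]]]
    by (simp add: model_of_def)
  show "we M = we (model_of F C)" by (simp add: we_eq model_of_def)
qed simp

lemma replacements_commute: "F (C x) \<cong> C (F x)"
proof -
  note F = monadD[OF fibrant_replacement_monad[OF fibrant]]
  note C = comonadD[OF cofibrant_replacement_comonad[OF cofibrant]]
  note RF = fibrant_replacement_acyclic[OF fibrant]
  note RC = cofibrant_replacement_acyclic[OF cofibrant]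
  \<comment> \<open>Two-out-of-three along \<open>C x \<le> C (F x) \<le> F x\<close> makes the
    first map a weak equivalence, and \<open>we_eq\<close> turns this into an inequality.\<close>
  have "(C x, F x) \<in> we M" using model_comp(2) RC(1) RF(2) by blast
  moreover have "C x \<le> C (F x)" using C(1) RF(3) by blast
  ultimately have "(C x, C (F x)) \<in> we M"
    using we_cancel_right[OF _ RC(3,1)] by blast
  then have "C (C (F x)) \<le> F (C x)" using we_eq by simp
  then have "C (F x) \<le> F (C x)" by (rule order_trans[OF C(3)])
  \<comment> \<open>\<open>F (C x)\<close> is cofibrant, since cofibrations compose, so it lifts
    against the acyclic fibration from \<open>C (F x)\<close> to \<open>F x\<close>.\<close>
  moreover have "F (C x) \<le> C (F x)"
  proof -
    obtain z where "initial z" "(z, C x) \<in> cof M"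
      using cofibrant by (auto simp: cofibrant_replacement_def)
    then have "(z, F (C x)) \<in> cof M" using model_comp(1) RF(1) by blast
    moreover have "z \<le> C (F x)" using \<open>initial z\<close> by (simp add: initial_def)
    moreover have "F (C x) \<le> F x" using F(1) RC(3) by blast
    ultimately show ?thesis using wfs_lift[OF wfs_acyclic_fib _ IntI[OF RC(1,2)]] by blast
  qed
  ultimately show ?thesis by (simp add: isomorphic_def)
qed

lemma replacements_condition_i: "condition_i F C"
proof -
  note F = monadD[OF fibrant_replacement_monad[OF fibrant]]
  note C = comonadD[OF cofibrant_replacement_comonad[OF cofibrant]]
  \<comment> \<open>This is the lift of the acyclic cofibration \<open>(x, F x)\<close> against the
    fibration \<open>(C y, y)\<close>.\<close>
  have "F x \<le> C y" if "x \<le> C y" "F x \<le> y" for x y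
    using wfs_lift[OF wfs_acyclic_cof _ cofibrant_replacement_acyclic(2)[OF cofibrant] that]
      fibrant_replacement_acyclic[OF fibrant] by blast
  moreover have "idempotent F" "idempotent C"
    using F(2,3) C(2,3) by (simp_all add: idempotent_def isomorphic_def)
  ultimately show ?thesis using replacements_commute by (simp add: condition_i_def)
qed

lemma replacements_condition_ii: "condition_ii F C"
  unfolding condition_ii_def
proof (intro allI impI, elim conjE)
  note F = monadD[OF fibrant_replacement_monad[OF fibrant]]
  note C = comonadD[OF cofibrant_replacement_comonad[OF cofibrant]]
  fix a b assume ab: "a \<le> b" "C b \<le> C a" "F b \<le> F a"
  \<comment> \<open>\<open>a \<rightarrow> b\<close> is both an acyclic cofibration and an acyclic fibration, so it lifts against itself.\<close>
  have "b \<le> F a" "C b \<le> a" using ab(2,3) F(2) C(2) order_trans by blast+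
  then have "(a, b) \<in> cof M \<inter> we M" "(a, b) \<in> we M \<inter> fib M"
    using ab(1) acyclic_cof_eq[OF fibrant] acyclic_fib_eq[OF cofibrant]
    by (auto simp: monad_acyclic_def comonad_acyclic_def)
  then show "b \<le> a" using wfs_lift[OF wfs_acyclic_cof, of a b a b] by blast
qed

end

section \<open>Uniqueness, transport and existence of replacements\<close>

lemma fibrant_replacement_iso:
  assumes "fibrant_replacement M F" "fibrant_replacement M G"
  shows "F x \<cong> G x"
  using fibrant_replacement_least[of F x "G x" x] fibrant_replacement_least[of G x "F x" x]
    fibrant_replacement_acyclic[of F x] fibrant_replacement_acyclic[of G x] assms
  by (simp add: isomorphic_def)

lemma cofibrant_replacement_iso:
  assumes "cofibrant_replacement M C" "cofibrant_replacement M D"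
  shows "C x \<cong> D x"
  using cofibrant_replacement_greatest[of C "D x" x x]
    cofibrant_replacement_greatest[of D "C x" x x]
    cofibrant_replacement_acyclic[of C x] cofibrant_replacement_acyclic[of D x] assms
  by (simp add: isomorphic_def)

lemma fibrant_replacement_transport:
  assumes "fibrant_replacement M F" "monad G" "\<And>x. F x \<cong> G x"
  shows "fibrant_replacement M G"
proof -
  have iso: "x \<cong> x" "G x \<cong> F x" for x using assms(3) by (auto simp: isomorphic_def)
  have "(x, G x) \<in> S" if "S \<in> {cof M, we M}" for x S
    using model_retract[of S x "F x" x "G x"] that iso monadD(2)[OF assms(2)]
      fibrant_replacement_acyclic[OF assms(1)] by blast
  moreover have "\<exists>t. terminal t \<and> (G x, t) \<in> fib M" for x
    using model_retract[of "fib M" "F x" _ "G x"] assms(1) iso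
    unfolding fibrant_replacement_def terminal_def by blast
  ultimately show ?thesis by (simp add: fibrant_replacement_def)
qed

lemma cofibrant_replacement_transport:
  assumes "cofibrant_replacement M C" "comonad D" "\<And>x. C x \<cong> D x"
  shows "cofibrant_replacement M D"
proof -
  have iso: "x \<cong> x" "D x \<cong> C x" for x using assms(3) by (auto simp: isomorphic_def)
  have "(D x, x) \<in> S" if "S \<in> {we M, fib M}" for x S
    using model_retract[of S "C x" x "D x" x] that iso comonadD(2)[OF assms(2)]
      cofibrant_replacement_acyclic[OF assms(1)] by blast
  moreover have "\<exists>z. initial z \<and> (z, D x) \<in> cof M" for x
    using model_retract[of "cof M" _ "C x" _ "D x"] assms(1) iso
    unfolding cofibrant_replacement_def initial_def by blast
  ultimately show ?thesis by (simp add: cofibrant_replacement_def)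
qed

text \<open>Factor the map from \<open>x\<close> to the terminal object and the map from the initial
  object to \<open>x\<close>, then choose the middle objects.\<close>

lemma replacements_exist:
  assumes "finitely_bicomplete TYPE('a)"
  obtains F C where "fibrant_replacement M F" "cofibrant_replacement M C"
proof -
  obtain t z :: 'a where tz: "terminal t" "initial z"
    using terminal_exists[OF assms] initial_exists[OF assms] by blast
  have "\<exists>y. (x, y) \<in> cof M \<inter> we M \<and> (y, t) \<in> fib M" for x
    using wfs_factor[OF wfs_acyclic_cof, of x t] tz unfolding terminal_def by blast
  then obtain F where F: "\<And>x. (x, F x) \<in> cof M \<inter> we M \<and> (F x, t) \<in> fib M" by metis
  have "\<exists>y. (z, y) \<in> cof M \<and> (y, x) \<in> we M \<inter> fib M" for x
    using wfs_factor[OF wfs_acyclic_fib, of z x] tz unfolding initial_def by blast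
  then obtain C where C: "\<And>x. (z, C x) \<in> cof M \<and> (C x, x) \<in> we M \<inter> fib M" by metis
  show thesis
    using that[of F C] F C tz unfolding fibrant_replacement_def cofibrant_replacement_def by blast
qed

lemma replacements_admissible:
  assumes "finitely_bicomplete TYPE('a)" "fibrant_replacement M F" "cofibrant_replacement M C"
  shows "(F, C) \<in> admissible_pairs"
  using replacements_condition_i[OF assms] replacements_condition_ii[OF assms]
    fibrant_replacement_monad[OF assms(2)] cofibrant_replacement_comonad[OF assms(3)]
  by (simp add: admissible_pairs_def)

text \<open>Uniqueness up to isomorphism gives one inclusion, transport along isomorphisms the
  other; so the class is an element of the quotient.\<close>

lemma replacement_class_eq:
  assumes "finitely_bicomplete TYPE('a)" "fibrant_replacement M F" "cofibrant_replacement M C"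
  shows "replacement_class M = pair_iso `` {(F, C)}"
proof (intro set_eqI iffI)
  fix p :: "('a \<Rightarrow> 'a) \<times> ('a \<Rightarrow> 'a)"
  obtain G D where p: "p = (G, D)" by (cases p)
  show "p \<in> pair_iso `` {(F, C)}" if "p \<in> replacement_class M"
  proof -
    have "fibrant_replacement M G" "cofibrant_replacement M D"
      using that by (auto simp: p replacement_class_def)
    then show ?thesis
      using replacements_admissible[OF assms(1)] assms(2,3)
        fibrant_replacement_iso[of F G] cofibrant_replacement_iso[of C D]
      by (simp add: p pair_iso_def)
  qed
  show "p \<in> replacement_class M" if "p \<in> pair_iso `` {(F, C)}"
  proof -
    have "monad G" "comonad D" "\<And>x. F x \<cong> G x" "\<And>x. C x \<cong> D x"
      using that by (auto simp: p pair_iso_def admissible_pairs_def)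
    then show ?thesis
      using fibrant_replacement_transport[OF assms(2)]
        cofibrant_replacement_transport[OF assms(3)]
      by (simp add: p replacement_class_def)
  qed
qed

end

section \<open>The correspondence with isomorphism classes of pairs\<close>

lemma model_of_admissible:
  fixes F C :: "'a::preorder \<Rightarrow> 'a"
  assumes "finitely_bicomplete TYPE('a)" "(F, C) \<in> admissible_pairs"
  shows "strong_model_structure (model_of F C)" "fibrant_replacement (model_of F C) F"
    "cofibrant_replacement (model_of F C) C"
proof -
  have FC: "monad F" "comonad C" "\<And>x. C (F x) \<le> F (C x)" "condition_ii F C"
    using assms(2) by (auto simp: admissible_pairs_def condition_i_def isomorphic_def)
  show "strong_model_structure (model_of F C)" "fibrant_replacement (model_of F C) F"
    "cofibrant_replacement (model_of F C) C"
    using strong_model_of[OF assms(1) FC] fibrant_replacement_model_of[OF assms(1) FC]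
      cofibrant_replacement_model_of[OF assms(1) FC] .
qed

theorem theorem3:
  assumes "finitely_bicomplete TYPE('a::preorder)"
  shows "(\<forall>F C :: 'a \<Rightarrow> 'a. monad F \<longrightarrow> comonad C \<longrightarrow>
            (\<exists>M. strong_model_structure M \<and> fibrant_replacement M F \<and> cofibrant_replacement M C)
              \<longleftrightarrow> condition_i F C \<and> condition_ii F C)
       \<and> bij_betw replacement_class
            {M :: 'a model. strong_model_structure M}
            (admissible_pairs // pair_iso)"
proof (intro conjI allI impI)
  fix F C :: "'a \<Rightarrow> 'a"
  assume FC: "monad F" "comonad C"
  show "(\<exists>M. strong_model_structure M \<and> fibrant_replacement M F \<and> cofibrant_replacement M C)
      \<longleftrightarrow> condition_i F C \<and> condition_ii F C"
    (is "?L \<longleftrightarrow> ?R")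
  proof
    show ?R if ?L
      using that replacements_condition_i[OF _ assms] replacements_condition_ii[OF _ assms] by blast
    show ?L if ?R
    proof -
      have "(F, C) \<in> admissible_pairs" using FC that by (simp add: admissible_pairs_def)
      then show ?L using model_of_admissible[OF assms] by blast
    qed
  qed
next
  show "bij_betw replacement_class {M :: 'a model. strong_model_structure M}
      (admissible_pairs // pair_iso)"
  proof (rule bij_betw_imageI)
    show "inj_on replacement_class {M :: 'a model. strong_model_structure M}"
    proof (rule inj_onI, unfold mem_Collect_eq)
      fix M N :: "'a model"
      assume M: "strong_model_structure M" and N: "strong_model_structure N"
        and eq: "replacement_class M = replacement_class N"
      obtain F C where FC: "fibrant_replacement M F" "cofibrant_replacement M C"
        using replacements_exist[OF M assms] .
      then have "(F, C) \<in> replacement_class M"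
        using fibrant_replacement_monad[OF M] cofibrant_replacement_comonad[OF M]
        by (simp add: replacement_class_def)
      \<comment> \<open>Equal classes make the pair chosen for \<open>M\<close> a pair of
        replacements for \<open>N\<close> too, and such a pair determines the model
        structure.\<close>
      then have FC': "fibrant_replacement N F" "cofibrant_replacement N C"
        unfolding eq by (simp_all add: replacement_class_def)
      show "M = N"
        by (rule trans[OF strong_model_eq_model_of[OF M assms FC]
            strong_model_eq_model_of[OF N assms FC', symmetric]])
    qed
    have "replacement_class M \<in> admissible_pairs // pair_iso"
      if M: "strong_model_structure M" for M :: "'a model"
    proof -
      obtain F C where FC: "fibrant_replacement M F" "cofibrant_replacement M C"
        using replacements_exist[OF M assms] .
      then show ?thesis
        unfolding replacement_class_eq[OF M assms FC]
        by (intro quotientI replacements_admissible[OF M assms])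
    qed
    moreover have "X \<in> replacement_class ` {M. strong_model_structure M}"
      if X: "X \<in> admissible_pairs // pair_iso" for X :: "(('a \<Rightarrow> 'a) \<times> ('a \<Rightarrow> 'a)) set"
    proof -
      obtain p where p: "p \<in> admissible_pairs" "X = pair_iso `` {p}"
        using X by (rule quotientE)
      obtain F C where "p = (F, C)" by (cases p)
      with p have FC: "(F, C) \<in> admissible_pairs" "X = pair_iso `` {(F, C)}" by simp_all
      \<comment> \<open>For surjectivity, the model structure built from a representative has
        \<open>F\<close> and \<open>C\<close> as replacements, so its class is the given
        one.\<close>
      note M = model_of_admissible[OF assms FC(1)]
      show ?thesis
        unfolding FC(2) replacement_class_eq[OF M(1) assms M(2,3), symmetric]
        by (rule imageI) (simp add: M(1))
    qed
    ultimately show "replacement_class ` {M :: 'a model. strong_model_structure M}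
        = admissible_pairs // pair_iso" by blast
  qed
qed

end
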